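(* Let $d\ge 1$ be an integer and let $\Phi:[0,\infty)\to\mathbb{R}$ satisfy $\Phi\in C^1([0,\infty))$ and $\inf_{\eta\ge 0}\Phi(\eta)>0$. Let $u_0,u_1\in l^2=l^2(\mathbb{Z}^d)$. Then there exists a unique global solution $u\in C^2([0,\infty);l^2)$ of the initial value problem $$u''(t)[n]-\Phi\left(\|\nabla^+u(t)\|^2\right)\Delta u(t)[n]=0\quad ((t,n)\in(0,\infty)\times\mathbb{Z}^d),$$ $$u(0)[n]=u_0[n],\quad u'(0)[n]=u_1[n]\quad (n\in\mathbb{Z}^d).$$ Moreover, with $$E(t;u):=\frac12\left(\int_0^{\|\nabla^+u(t)\|^2}\Phi(\eta)\,d\eta+\|u'(t)\|^2\right),$$ one has the energy conservation $E(t;u)=E(0;u)$ for all $t>0$.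
   Context: $l^2$ is the Hilbert space of complex-valued arrays $f=\{f[n]\}_{n\in\mathbb{Z}^d}$ with $\|f\|:=\left(\sum_{n\in\mathbb{Z}^d}|f[n]|^2\right)^{1/2}<\infty$ and inner product $(f,g)=\sum_{n\in\mathbb{Z}^d}f[n]\overline{g[n]}$. With $e_1,\dots,e_d$ the standard basis of $\mathbb{R}^d$, for $j=1,\dots,d$ put $D_j^+f[n]:=f[n+e_j]-f[n]$ and $D_j^-f[n]:=f[n]-f[n-e_j]$. Write $\nabla^+f=(D_1^+f,\dots,D_d^+f)$ and $\|\nabla^+f\|^2:=\sum_{j=1}^d\|D_j^+f\|^2$. The discrete Laplacian is $\Delta:=\sum_{j=1}^dD_j^+D_j^-$, i.e. $\Delta f[n]=\sum_{j=1}^d\left(f[n+e_j]-2f[n]+f[n-e_j]\right)$. The prime denotes $\frac{d}{dt}$. *)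

theory Defs
  imports "HOL-Analysis.Analysis"
begin

subsection \<open>Square-summable complex arrays\<close>

typedef 'i ell2 = "{f :: 'i \<Rightarrow> complex. (\<lambda>n. (cmod (f n))\<^sup>2) summable_on UNIV}"
  morphisms ell2_nth Abs_ell2
  by (rule exI[of _ "\<lambda>_. 0"]) simp

setup_lifting type_definition_ell2

lemma ell2_eqI: "(\<And>n. ell2_nth f n = ell2_nth g n) \<Longrightarrow> f = g"
  by (metis ell2_nth_inject ext)

lemma ell2_nth_summable: "(\<lambda>n. (cmod (ell2_nth f n))\<^sup>2) summable_on UNIV"
  using ell2_nth[of f] by simp

lemma square_summable_add:
  fixes f g :: "'i \<Rightarrow> complex"
  assumes "(\<lambda>n. (cmod (f n))\<^sup>2) summable_on UNIV" "(\<lambda>n. (cmod (g n))\<^sup>2) summable_on UNIV"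
  shows "(\<lambda>n. (cmod (f n + g n))\<^sup>2) summable_on UNIV"
proof (rule summable_on_comparison_test)
  show "(\<lambda>n. 2 * (cmod (f n))\<^sup>2 + 2 * (cmod (g n))\<^sup>2) summable_on UNIV"
    by (intro summable_on_add summable_on_cmult_right assms)
  fix n
  have "(cmod (f n + g n))\<^sup>2 \<le> (cmod (f n) + cmod (g n))\<^sup>2"
    by (intro power_mono norm_triangle_ineq) simp
  also have "\<dots> \<le> 2 * (cmod (f n))\<^sup>2 + 2 * (cmod (g n))\<^sup>2"
    using zero_le_power2[of "cmod (f n) - cmod (g n)"]
    by (simp add: power2_eq_square algebra_simps)
  finally show "(cmod (f n + g n))\<^sup>2 \<le> 2 * (cmod (f n))\<^sup>2 + 2 * (cmod (g n))\<^sup>2" .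
qed simp

lemma square_summable_cmult:
  fixes f :: "'i \<Rightarrow> complex"
  assumes "(\<lambda>n. (cmod (f n))\<^sup>2) summable_on UNIV"
  shows "(\<lambda>n. (cmod (c * f n))\<^sup>2) summable_on UNIV"
  using summable_on_cmult_right[OF assms, of "(cmod c)\<^sup>2"]
  by (simp add: norm_mult power_mult_distrib)

lemma square_summable_inner:
  fixes f g :: "'i \<Rightarrow> complex"
  assumes "(\<lambda>n. (cmod (f n))\<^sup>2) summable_on UNIV" "(\<lambda>n. (cmod (g n))\<^sup>2) summable_on UNIV"
  shows "(\<lambda>n. f n \<bullet> g n) summable_on UNIV"
proof (rule abs_summable_summable, rule summable_on_comparison_test)
  show "(\<lambda>n. (cmod (f n))\<^sup>2 + (cmod (g n))\<^sup>2) summable_on UNIV"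
    by (intro summable_on_add assms)
  fix n
  have "\<bar>f n \<bullet> g n\<bar> \<le> cmod (f n) * cmod (g n)"
    by (rule Cauchy_Schwarz_ineq2)
  also have "\<dots> \<le> (cmod (f n))\<^sup>2 + (cmod (g n))\<^sup>2"
  proof -
    have "0 \<le> cmod (f n) * cmod (g n)" by simp
    with sum_squares_bound[of "cmod (f n)" "cmod (g n)"] show ?thesis
      unfolding mult.assoc by linarith
  qed
  finally show "norm (f n \<bullet> g n) \<le> (cmod (f n))\<^sup>2 + (cmod (g n))\<^sup>2" by simp
qed simp

text \<open>
  The Hilbert space structure over the reals. On \<^typ>\<open>complex\<close> the library's \<^const>\<open>inner\<close> is
  the real part of \<open>z * cnj w\<close>, so the real inner product below is the real part of the Hermitian one
  \<open>\<Sum>n. f n * cnj (g n)\<close>, and both induce the same norm.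
\<close>

instantiation ell2 :: (type) real_inner
begin

lift_definition zero_ell2 :: "'a ell2" is "\<lambda>_. 0" by simp

lift_definition plus_ell2 :: "'a ell2 \<Rightarrow> 'a ell2 \<Rightarrow> 'a ell2" is "\<lambda>f g n. f n + g n"
  by (rule square_summable_add)

lift_definition uminus_ell2 :: "'a ell2 \<Rightarrow> 'a ell2" is "\<lambda>f n. - f n" by simp

lift_definition minus_ell2 :: "'a ell2 \<Rightarrow> 'a ell2 \<Rightarrow> 'a ell2" is "\<lambda>f g n. f n - g n"
  using square_summable_add[where g = "\<lambda>n. - g n" for g :: "'a \<Rightarrow> complex"] by simp

lift_definition scaleR_ell2 :: "real \<Rightarrow> 'a ell2 \<Rightarrow> 'a ell2" is "\<lambda>r f n. r *\<^sub>R f n"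
  unfolding scaleR_conv_of_real by (rule square_summable_cmult)

definition norm_ell2 :: "'a ell2 \<Rightarrow> real" where
  "norm_ell2 f = sqrt (\<Sum>\<^sub>\<infinity>n. (cmod (ell2_nth f n))\<^sup>2)"

definition inner_ell2 :: "'a ell2 \<Rightarrow> 'a ell2 \<Rightarrow> real" where
  "inner_ell2 f g = (\<Sum>\<^sub>\<infinity>n. ell2_nth f n \<bullet> ell2_nth g n)"

definition sgn_ell2 :: "'a ell2 \<Rightarrow> 'a ell2" where
  "sgn_ell2 f = inverse (norm f) *\<^sub>R f"

definition dist_ell2 :: "'a ell2 \<Rightarrow> 'a ell2 \<Rightarrow> real" where
  "dist_ell2 f g = norm (f - g)"

definition uniformity_ell2 :: "('a ell2 \<times> 'a ell2) filter" where
  "uniformity_ell2 = (INF e\<in>{0 <..}. principal {(f, g). dist f g < e})"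

definition open_ell2 :: "'a ell2 set \<Rightarrow> bool" where
  "open_ell2 U \<longleftrightarrow> (\<forall>f\<in>U. eventually (\<lambda>(f', g). f' = f \<longrightarrow> g \<in> U) uniformity)"

instance
proof
  fix f g h :: "'a ell2" and r s :: real
  note inner_summable =
    square_summable_inner[OF ell2_nth_summable ell2_nth_summable]
  show "f + g + h = f + (g + h)" by transfer (simp add: add.assoc)
  show "f + g = g + f" by transfer (simp add: add.commute)
  show "0 + f = f" by transfer simp
  show "- f + f = 0" by transfer simp
  show "f - g = f + - g" by transfer simp
  show "r *\<^sub>R (f + g) = r *\<^sub>R f + r *\<^sub>R g" by transfer (simp add: scaleR_add_right)
  show "(r + s) *\<^sub>R f = r *\<^sub>R f + s *\<^sub>R f" by transfer (simp add: scaleR_add_left)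
  show "r *\<^sub>R s *\<^sub>R f = (r * s) *\<^sub>R f" by transfer simp
  show "1 *\<^sub>R f = f" by transfer simp
  show "sgn f = inverse (norm f) *\<^sub>R f" by (rule sgn_ell2_def)
  show "dist f g = norm (f - g)" by (rule dist_ell2_def)
  show "(uniformity :: ('a ell2 \<times> 'a ell2) filter) = (INF e\<in>{0 <..}. principal {(f, g). dist f g < e})"
    by (rule uniformity_ell2_def)
  show "open U \<longleftrightarrow> (\<forall>f\<in>U. eventually (\<lambda>(f', g). f' = f \<longrightarrow> g \<in> U) uniformity)" for U :: "'a ell2 set"
    by (rule open_ell2_def)
  show "inner f g = inner g f" by (simp add: inner_ell2_def inner_commute)
  show "inner (f + g) h = inner f h + inner g h"
    unfolding inner_ell2_def
    by (simp add: plus_ell2.rep_eq inner_add_left infsum_add[OF inner_summable inner_summable])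
  show "inner (r *\<^sub>R f) g = r * inner f g"
    unfolding inner_ell2_def by (simp add: scaleR_ell2.rep_eq infsum_cmult_right')
  show "0 \<le> inner f f" unfolding inner_ell2_def by (intro infsum_nonneg) simp
  show "inner f f = 0 \<longleftrightarrow> f = 0"
  proof
    assume "inner f f = 0"
    then have "ell2_nth f n \<bullet> ell2_nth f n = 0" for n
      using nonneg_infsum_le_0D[OF _ inner_summable, of f f n] unfolding inner_ell2_def by simp
    then show "f = 0" by (intro ell2_eqI) (simp add: zero_ell2.rep_eq)
  qed (simp add: inner_ell2_def zero_ell2.rep_eq)
  show "norm f = sqrt (inner f f)"
    unfolding norm_ell2_def inner_ell2_def by (simp add: dot_square_norm)
qed

end

lemma ell2_norm_square: "(norm f)\<^sup>2 = (\<Sum>\<^sub>\<infinity>n. (cmod (ell2_nth f n))\<^sup>2)"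
  unfolding norm_ell2_def by (simp add: infsum_nonneg)

lemma ell2_nth_norm_le: "cmod (ell2_nth f n) \<le> norm f"
proof -
  have "(cmod (ell2_nth f n))\<^sup>2 \<le> (norm f)\<^sup>2"
    using finite_sum_le_infsum[OF ell2_nth_summable[of f], of "{n}"]
    by (simp add: ell2_norm_square)
  then show ?thesis by (simp add: power2_le_iff_abs_le)
qed

instance ell2 :: (type) banach
proof
  fix X :: "nat \<Rightarrow> 'a ell2"
  assume X: "Cauchy X"
  have "\<exists>l. (\<lambda>k. ell2_nth (X k) n) \<longlonglongrightarrow> l" for n
  proof -
    have "Cauchy (\<lambda>k. ell2_nth (X k) n)"
    proof (rule metric_CauchyI)
      fix e :: real assume "0 < e"
      with X obtain M where "\<forall>i\<ge>M. \<forall>j\<ge>M. dist (X i) (X j) < e"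
        by (meson metric_CauchyD)
      moreover have "dist (ell2_nth (X i) n) (ell2_nth (X j) n) \<le> dist (X i) (X j)" for i j
        using ell2_nth_norm_le[of "X i - X j" n] by (simp add: dist_norm minus_ell2.rep_eq)
      ultimately show "\<exists>M. \<forall>i\<ge>M. \<forall>j\<ge>M. dist (ell2_nth (X i) n) (ell2_nth (X j) n) < e"
        by (meson le_less_trans)
    qed
    then show ?thesis by (simp add: Cauchy_convergent_iff convergent_def)
  qed
  then obtain g where g: "\<And>n. (\<lambda>k. ell2_nth (X k) n) \<longlonglongrightarrow> g n" by metis
  have bound: "\<exists>M. \<forall>i\<ge>M. \<forall>F. finite F \<longrightarrow> (\<Sum>n\<in>F. (cmod (ell2_nth (X i) n - g n))\<^sup>2) \<le> e\<^sup>2"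
    if e: "0 < e" for e :: real
  proof -
    from X e obtain M where M: "\<And>i j. i \<ge> M \<Longrightarrow> j \<ge> M \<Longrightarrow> dist (X i) (X j) < e"
      by (meson metric_CauchyD)
    have "(\<Sum>n\<in>F. (cmod (ell2_nth (X i) n - g n))\<^sup>2) \<le> e\<^sup>2" if "i \<ge> M" "finite F" for i F
    proof (rule LIMSEQ_le_const2)
      show "(\<lambda>j. \<Sum>n\<in>F. (cmod (ell2_nth (X i) n - ell2_nth (X j) n))\<^sup>2)
        \<longlonglongrightarrow> (\<Sum>n\<in>F. (cmod (ell2_nth (X i) n - g n))\<^sup>2)"
        by (intro tendsto_intros g)
      have "(\<Sum>n\<in>F. (cmod (ell2_nth (X i) n - ell2_nth (X j) n))\<^sup>2) \<le> e\<^sup>2" if "j \<ge> M" for j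
      proof -
        have "(\<Sum>n\<in>F. (cmod (ell2_nth (X i) n - ell2_nth (X j) n))\<^sup>2) \<le> (norm (X i - X j))\<^sup>2"
          using finite_sum_le_infsum[OF ell2_nth_summable[of "X i - X j"] \<open>finite F\<close>]
          by (simp add: ell2_norm_square minus_ell2.rep_eq)
        also have "\<dots> \<le> e\<^sup>2"
          using M[OF \<open>i \<ge> M\<close> \<open>j \<ge> M\<close>] by (intro power_mono) (auto simp: dist_norm)
        finally show ?thesis .
      qed
      then show "\<exists>N. \<forall>j\<ge>N. (\<Sum>n\<in>F. (cmod (ell2_nth (X i) n - ell2_nth (X j) n))\<^sup>2) \<le> e\<^sup>2"
        by blast
    qed
    then show ?thesis by blast
  qed
  have diff: "(\<lambda>n. (cmod (ell2_nth (X i) n - g n))\<^sup>2) summable_on UNIV"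
    if "\<forall>F. finite F \<longrightarrow> (\<Sum>n\<in>F. (cmod (ell2_nth (X i) n - g n))\<^sup>2) \<le> B" for i B
    using that by (intro nonneg_bdd_above_summable_on bdd_aboveI2) auto
  obtain N where "\<forall>F. finite F \<longrightarrow> (\<Sum>n\<in>F. (cmod (ell2_nth (X N) n - g n))\<^sup>2) \<le> 1\<^sup>2"
    using bound[of 1] by auto
  from square_summable_add[OF square_summable_cmult[OF diff[OF this], of "-1"] ell2_nth_summable[of "X N"]]
  have "(\<lambda>n. (cmod (g n))\<^sup>2) summable_on UNIV" by simp
  then obtain G where G: "ell2_nth G = g" by (metis Abs_ell2_inverse mem_Collect_eq)
  have "X \<longlonglongrightarrow> G"
  proof (rule metric_LIMSEQ_I)
    fix e :: real assume e: "0 < e"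
    then obtain M where
      M: "\<And>i F. i \<ge> M \<Longrightarrow> finite F \<Longrightarrow> (\<Sum>n\<in>F. (cmod (ell2_nth (X i) n - g n))\<^sup>2) \<le> (e / 2)\<^sup>2"
      using bound[of "e / 2"] by auto
    have "dist (X i) G < e" if "i \<ge> M" for i
    proof -
      have "(norm (X i - G))\<^sup>2 \<le> (e / 2)\<^sup>2"
        unfolding ell2_norm_square using M[OF that] diff[of i]
        by (intro infsum_le_finite_sums) (auto simp: minus_ell2.rep_eq G)
      then have "norm (X i - G) \<le> e / 2"
        by (rule power2_le_imp_le) (use e in simp)
      with e show ?thesis by (simp add: dist_norm)
    qed
    then show "\<exists>M. \<forall>i\<ge>M. dist (X i) G < e" by blast
  qed
  then show "convergent X" by (auto simp: convergent_def)
qed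

subsection \<open>Difference operators on the lattice\<close>

lemma square_summable_shift:
  fixes f :: "'a::group_add \<Rightarrow> complex"
  assumes "(\<lambda>n. (cmod (f n))\<^sup>2) summable_on UNIV"
  shows "(\<lambda>n. (cmod (f (n + a)))\<^sup>2) summable_on UNIV"
proof -
  have "bij (\<lambda>n. n + a)"
    by (rule o_bij[where g = "\<lambda>n. n - a"]) (auto simp: fun_eq_iff)
  from summable_on_reindex_bij_betw[OF this, of "\<lambda>n. (cmod (f n))\<^sup>2"] assms show ?thesis by simp
qed

text \<open>The lattice is \<^typ>\<open>int ^ 'd\<close>, and \<open>axis j 1\<close> is its \<open>j\<close>-th standard basis vector.\<close>

lift_definition Dplus :: "'d::finite \<Rightarrow> (int ^ 'd) ell2 \<Rightarrow> (int ^ 'd) ell2"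
  is "\<lambda>j f n. f (n + axis j 1) - f n"
  using square_summable_add[OF square_summable_shift square_summable_cmult[where c = "-1"]] by simp

lift_definition Dminus :: "'d::finite \<Rightarrow> (int ^ 'd) ell2 \<Rightarrow> (int ^ 'd) ell2"
  is "\<lambda>j f n. f n - f (n - axis j 1)"
  subgoal for j f
    using square_summable_add[OF _ square_summable_cmult[OF square_summable_shift, where c = "-1"],
        of f f "- axis j 1"]
    by simp
  done

definition grad_plus :: "(int ^ 'd::finite) ell2 \<Rightarrow> (int ^ 'd) ell2 ^ 'd" where
  "grad_plus f = (\<chi> j. Dplus j f)"

definition laplacian :: "(int ^ 'd::finite) ell2 \<Rightarrow> (int ^ 'd) ell2" where
  "laplacian f = (\<Sum>j\<in>UNIV. Dplus j (Dminus j f))"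

lemma norm_grad_plus_square: "(norm (grad_plus f))\<^sup>2 = (\<Sum>j\<in>UNIV. (norm (Dplus j f))\<^sup>2)"
  by (simp add: grad_plus_def norm_vec_def L2_set_def sum_nonneg)

lemma ell2_nth_sum: "ell2_nth (\<Sum>j\<in>A. f j) n = (\<Sum>j\<in>A. ell2_nth (f j) n)"
  by (induction A rule: infinite_finite_induct) (auto simp: zero_ell2.rep_eq plus_ell2.rep_eq)

lemma ell2_nth_laplacian:
  "ell2_nth (laplacian f) n
    = (\<Sum>j\<in>UNIV. ell2_nth f (n + axis j 1) - 2 * ell2_nth f n + ell2_nth f (n - axis j 1))"
  by (simp add: laplacian_def ell2_nth_sum Dplus.rep_eq Dminus.rep_eq algebra_simps)

subsection \<open>Continuously differentiable functions on the closed half-line\<close>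

text \<open>
  Functions on \<open>[0,\<infinity>)\<close> are total functions on the reals whose values at negative arguments are
  irrelevant. The derivative is taken within \<open>{0..}\<close>, i.e. it is one-sided at 0 and the ordinary
  derivative at every positive argument.
\<close>

definition hderiv :: "(real \<Rightarrow> 'a::real_normed_vector) \<Rightarrow> real \<Rightarrow> 'a" where
  "hderiv f t = vector_derivative f (at t within {0..})"

primrec Ck_halfline :: "nat \<Rightarrow> (real \<Rightarrow> 'a::real_normed_vector) \<Rightarrow> bool" where
  "Ck_halfline 0 f \<longleftrightarrow> continuous_on {0..} f"
| "Ck_halfline (Suc k) f \<longleftrightarrow> f differentiable_on {0..} \<and> Ck_halfline k (hderiv f)"

subsection \<open>The initial value problem and its energy\<close>

definition kirchhoff_solution ::
  "(real \<Rightarrow> real) \<Rightarrow> (int ^ 'd::finite) ell2 \<Rightarrow> (int ^ 'd) ell2 \<Rightarrow> (real \<Rightarrow> (int ^ 'd) ell2) \<Rightarrow> bool"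
where
  "kirchhoff_solution \<Phi> u0 u1 u \<longleftrightarrow>
    Ck_halfline 2 u \<and>
    (\<forall>t>0. \<forall>n. ell2_nth (hderiv (hderiv u) t) n
      - complex_of_real (\<Phi> ((norm (grad_plus (u t)))\<^sup>2)) * ell2_nth (laplacian (u t)) n = 0) \<and>
    (\<forall>n. ell2_nth (u 0) n = ell2_nth u0 n) \<and>
    (\<forall>n. ell2_nth (hderiv u 0) n = ell2_nth u1 n)"

definition energy :: "(real \<Rightarrow> real) \<Rightarrow> (real \<Rightarrow> (int ^ 'd::finite) ell2) \<Rightarrow> real \<Rightarrow> real" where
  "energy \<Phi> u t =
    1 / 2 * (integral {0..(norm (grad_plus (u t)))\<^sup>2} \<Phi> + (norm (hderiv u t))\<^sup>2)"

end

theory Submission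
  imports Defs
begin

text \<open>
  Written as a first-order system for the pair \<open>(u, u')\<close>, the equation is an ordinary differential
  equation in a Hilbert space whose right-hand side is only locally Lipschitz. Two observations
  turn it into a problem for a globally Lipschitz field.

  The forward and backward differences are adjoint up to sign, so
  \<open>\<langle>\<nabla>\<^sup>+u, \<nabla>\<^sup>+v\<rangle> = -\<langle>\<Delta>u, v\<rangle>\<close> and the energy of every solution has derivative 0
  (\<open>energy_conserved\<close>). If \<open>\<Phi> \<ge> c > 0\<close>, the conserved energy bounds \<open>\<parallel>\<nabla>\<^sup>+u(t)\<parallel>\<^sup>2\<close> by a constant
  \<open>R\<close> determined by \<open>\<Phi>\<close>, \<open>c\<close> and the initial data, uniformly in \<open>t\<close> (\<open>gradient_bound\<close>). Hence \<open>\<Phi>(\<eta>)\<close> may be replaced by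
  \<open>\<Phi>(min \<eta> R)\<close>: both nonlinearities obey the same bound, and their initial value problems have
  the same solutions (\<open>kirchhoff_solution_cutoff_iff\<close>).

  On the lattice \<open>\<Delta>\<close> factors through the gradient by bounded operators,
  \<open>\<parallel>\<Delta>u\<parallel> \<le> 2d \<parallel>\<nabla>\<^sup>+u\<parallel>\<close>. So \<open>\<Delta>u\<close> is bounded wherever the cut-off coefficient is not yet constant,
  which makes the cut-off field globally Lipschitz (\<open>cutoff_field_lipschitz\<close>) although it is
  unbounded. For such a field a contraction argument in an exponentially weighted sup norm gives a
  solution on the whole half-line at once (\<open>lipschitz_ode_solution_exists\<close>), without any
  continuation argument, and a Gronwall argument gives uniqueness
  (\<open>lipschitz_ode_solution_unique\<close>).
\<close>

section \<open>Difference operators on square-summable arrays\<close>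

text \<open>
  The translation operators are unitary, and both differences are the identity minus a translation,
  up to sign. Adjointness and boundedness of the differences follow from this.
\<close>

lift_definition shift :: "'a::group_add \<Rightarrow> 'a ell2 \<Rightarrow> 'a ell2" is "\<lambda>a f n. f (n + a)"
  by (rule square_summable_shift)

lemma inner_shift: "shift a f \<bullet> g = f \<bullet> shift (- a) g"
proof -
  have bij: "bij (\<lambda>n. n + a)"
    by (rule o_bij[where g = "\<lambda>n. n - a"]) (auto simp: fun_eq_iff)
  show ?thesis
    using infsum_reindex_bij_betw[OF bij, of "\<lambda>n. ell2_nth f n \<bullet> ell2_nth g (n + - a)"]
    by (simp add: inner_ell2_def shift.rep_eq add.assoc del: add_uminus_conv_diff)
qed

lemma shift_shift: "shift a (shift b f) = shift (a + b) f"
  by (rule ell2_eqI) (simp add: shift.rep_eq add.assoc)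

lemma shift_zero: "shift 0 f = f"
  by (rule ell2_eqI) (simp add: shift.rep_eq)

lemma norm_shift: "norm (shift a f) = norm f"
  by (simp add: norm_eq_sqrt_inner inner_shift shift_shift shift_zero)

lemma Dplus_eq_shift: "Dplus j f = shift (axis j 1) f - f"
  by (rule ell2_eqI) (simp add: Dplus.rep_eq shift.rep_eq minus_ell2.rep_eq)

lemma Dminus_eq_shift: "Dminus j f = f - shift (- axis j 1) f"
  by (rule ell2_eqI) (simp add: Dminus.rep_eq shift.rep_eq minus_ell2.rep_eq)

lemma linear_Dplus: "linear (Dplus j)"
  by (rule linearI; rule ell2_eqI)
    (simp_all add: Dplus.rep_eq plus_ell2.rep_eq scaleR_ell2.rep_eq algebra_simps)

lemma linear_Dminus: "linear (Dminus j)"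
  by (rule linearI; rule ell2_eqI)
    (simp_all add: Dminus.rep_eq plus_ell2.rep_eq scaleR_ell2.rep_eq algebra_simps)

lemma norm_Dplus_le: "norm (Dplus j f) \<le> 2 * norm f"
  using norm_triangle_ineq4[of "shift (axis j 1) f" f] by (simp add: Dplus_eq_shift norm_shift)

lemma norm_Dminus_le: "norm (Dminus j f) \<le> 2 * norm f"
  using norm_triangle_ineq4[of f "shift (- axis j 1) f"] by (simp add: Dminus_eq_shift norm_shift)

lemma Dplus_Dminus_commute: "Dplus j (Dminus j f) = Dminus j (Dplus j f)"
  by (rule ell2_eqI) (simp add: Dplus.rep_eq Dminus.rep_eq)

lemma inner_Dplus: "Dplus j f \<bullet> g = - (f \<bullet> Dminus j g)"
  by (simp add: Dplus_eq_shift Dminus_eq_shift inner_shift inner_diff_left inner_diff_right)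

lemma grad_plus_nth: "grad_plus f $ j = Dplus j f"
  by (simp add: grad_plus_def)

lemma bounded_linear_grad_plus: "bounded_linear (grad_plus :: (int ^ 'd::finite) ell2 \<Rightarrow> _)"
proof (rule bounded_linear_intro[where K = "2 * real CARD('d)"])
  fix f :: "(int ^ 'd) ell2"
  have "norm (grad_plus f) \<le> (\<Sum>j\<in>UNIV. norm (Dplus j f))"
    unfolding norm_vec_def grad_plus_nth by (intro L2_set_le_sum) simp
  also have "\<dots> \<le> (\<Sum>j\<in>(UNIV :: 'd set). 2 * norm f)"
    by (intro sum_mono norm_Dplus_le)
  finally show "norm (grad_plus f) \<le> norm f * (2 * real CARD('d))"
    by (simp add: mult_ac)
qed (auto simp: vec_eq_iff grad_plus_nth linear_add[OF linear_Dplus] linear_scale[OF linear_Dplus])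

lemma linear_laplacian: "linear laplacian"
  by (rule linearI)
    (simp_all add: laplacian_def linear_add[OF linear_Dplus] linear_add[OF linear_Dminus]
      linear_scale[OF linear_Dplus] linear_scale[OF linear_Dminus] sum.distrib scaleR_sum_right)

text \<open>
  The Laplacian is the discrete divergence of the gradient, and the divergence is a bounded
  operator.
\<close>

lemma norm_laplacian_le:
  fixes f :: "(int ^ 'd::finite) ell2"
  shows "norm (laplacian f) \<le> 2 * real CARD('d) * norm (grad_plus f)"
proof -
  have "norm (laplacian f) \<le> (\<Sum>j\<in>UNIV. norm (Dminus j (Dplus j f)))"
    unfolding laplacian_def Dplus_Dminus_commute by (rule norm_sum)
  also have "\<dots> \<le> (\<Sum>j\<in>(UNIV :: 'd set). 2 * norm (grad_plus f))"
  proof (rule sum_mono)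
    fix j
    have "norm (Dplus j f) \<le> norm (grad_plus f)"
      using Finite_Cartesian_Product.norm_nth_le[of "grad_plus f" j] by (simp add: grad_plus_nth)
    then show "norm (Dminus j (Dplus j f)) \<le> 2 * norm (grad_plus f)"
      using norm_Dminus_le[of j "Dplus j f"] by linarith
  qed
  finally show ?thesis by simp
qed

lemma bounded_linear_laplacian: "bounded_linear (laplacian :: (int ^ 'd::finite) ell2 \<Rightarrow> _)"
proof -
  obtain B where B: "\<And>f :: (int ^ 'd) ell2. norm (grad_plus f) \<le> norm f * B"
    using bounded_linear.bounded[OF bounded_linear_grad_plus] by blast
  show ?thesis
  proof (rule bounded_linear_intro[where K = "2 * real CARD('d) * B"])
    fix f :: "(int ^ 'd) ell2"
    have "2 * real CARD('d) * norm (grad_plus f) \<le> 2 * real CARD('d) * (norm f * B)"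
      by (intro mult_left_mono B) simp
    with norm_laplacian_le[of f] have "norm (laplacian f) \<le> 2 * real CARD('d) * (norm f * B)"
      by linarith
    then show "norm (laplacian f) \<le> norm f * (2 * real CARD('d) * B)"
      by (simp add: mult_ac)
  qed (simp_all add: linear_add[OF linear_laplacian] linear_scale[OF linear_laplacian])
qed

text \<open>
  Summation by parts in each coordinate direction; the two differences in a direction commute, so
  the order in which they appear in the Laplacian does not matter.
\<close>

lemma inner_grad_plus: "grad_plus f \<bullet> grad_plus g = - (laplacian f \<bullet> g)"
proof -
  have "Dplus j f \<bullet> Dplus j g = - (Dplus j (Dminus j f) \<bullet> g)" for j
    using inner_Dplus[of j g "Dplus j f"] by (simp add: Dplus_Dminus_commute inner_commute)
  then show ?thesis
    by (simp add: inner_vec_def grad_plus_nth laplacian_def inner_sum_left sum_negf)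
qed

section \<open>Calculus on the half-line\<close>

lemma has_vector_derivative_hderiv:
  assumes "f differentiable_on {0..}" "0 \<le> t"
  shows "(f has_vector_derivative hderiv f t) (at t within {0..})"
  using assms by (simp add: differentiable_on_def hderiv_def vector_derivative_works[symmetric])

lemma hderiv_eqI:
  assumes "(f has_vector_derivative d) (at t within {0..})" "0 \<le> t"
  shows "hderiv f t = d"
proof -
  have "at t within {0..} \<noteq> bot"
    using at_le[of "{t<..}" "{0..}" t] assms(2) trivial_limit_at_right_real[of t]
    by (fastforce simp: bot_unique)
  then show ?thesis unfolding hderiv_def by (rule vector_derivative_within[OF _ assms(1)])
qed

lemma has_vector_derivative_at_interior:
  fixes f :: "real \<Rightarrow> 'a::real_normed_vector"
  assumes "(f has_vector_derivative d) (at t within {0..})" "0 < t"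
  shows "(f has_vector_derivative d) (at t)"
  using assms at_within_interior[of t "{0..}"] by simp

lemma continuous_on_halflineI:
  fixes f :: "real \<Rightarrow> 'a::real_normed_vector"
  assumes "\<And>t. 0 \<le> t \<Longrightarrow> (f has_vector_derivative d t) (at t within {0..})"
  shows "continuous_on {0..} f"
  using assms has_vector_derivative_continuous
  by (force simp: continuous_on_eq_continuous_within)

lemma integral_has_vector_derivative_halfline:
  fixes f :: "real \<Rightarrow> 'a::banach"
  assumes "continuous_on {0..} f" "0 \<le> t"
  shows "((\<lambda>s. integral {0..s} f) has_vector_derivative f t) (at t within {0..})"
proof -
  have "((\<lambda>s. integral {0..s} f) has_vector_derivative f t) (at t within {0..t + 1})"
    by (rule integral_has_vector_derivative)
      (use assms in \<open>auto intro: continuous_on_subset\<close>)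
  moreover have "at t within {0..t + 1} = at t within {0..}"
    by (rule at_within_nhd[of _ "{..<t + 1}"]) (use assms in auto)
  ultimately show ?thesis by simp
qed

section \<open>Globally Lipschitz differential equations\<close>

text \<open>
  In the norm \<open>sup\<^sub>t exp(-l t) \<parallel>f t\<parallel>\<close> integration from 0 has operator norm at most \<open>1 / l\<close>.
\<close>

lemma norm_integral_exp_weight_le:
  fixes f :: "real \<Rightarrow> 'a::banach"
  assumes "continuous_on {0..t} f" "0 \<le> t" "0 < l" "0 \<le> K"
    and "\<And>s. 0 \<le> s \<Longrightarrow> s \<le> t \<Longrightarrow> norm (f s) \<le> K * exp (l * s)"
  shows "exp (- (l * t)) * norm (integral {0..t} f) \<le> K / l"
proof -
  have int: "((\<lambda>s. K * exp (l * s)) has_integral K * exp (l * t) / l - K * exp (l * 0) / l) {0..t}"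
    by (rule fundamental_theorem_of_calculus)
      (use assms in \<open>auto intro!: derivative_eq_intros
        simp: has_real_derivative_iff_has_vector_derivative[symmetric]\<close>)
  have "norm (integral {0..t} f) \<le> integral {0..t} (\<lambda>s. K * exp (l * s))"
    using assms int by (intro integral_norm_bound_integral integrable_continuous_real continuous_intros) auto
  also have "\<dots> \<le> K * exp (l * t) / l"
    using integral_unique[OF int] assms by simp
  finally have "exp (- (l * t)) * norm (integral {0..t} f) \<le> exp (- (l * t)) * (K * exp (l * t) / l)"
    by (rule mult_left_mono) simp
  also have "\<dots> = K / l" by (simp add: exp_minus)
  finally show ?thesis .
qed

text \<open>
  The substitution \<open>w(t) = w\<^sub>0 + exp(l t) z(t)\<close> with \<open>l\<close> twice a positive Lipschitz constant turns the
  integral equation into a fixed-point equation for a bounded continuous \<open>z\<close>, with a contraction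
  of factor \<open>1/2\<close>. One application of Banach's theorem thus covers all of \<open>[0,\<infinity>)\<close>.
\<close>

lemma lipschitz_ode_solution_exists:
  fixes F :: "'a::banach \<Rightarrow> 'a"
  assumes L: "\<And>x y. norm (F x - F y) \<le> L * norm (x - y)"
  obtains w where "w 0 = w0"
    and "\<And>t. 0 \<le> t \<Longrightarrow> (w has_vector_derivative F (w t)) (at t within {0..})"
proof -
  define M where "M = max L 1"
  define l where "l = 2 * M"
  have M: "M > 0" and l: "l > 0" by (auto simp: M_def l_def)
  have lip: "norm (F x - F y) \<le> M * norm (x - y)" for x y
    by (rule order_trans[OF L mult_right_mono]) (auto simp: M_def)
  have "M-lipschitz_on UNIV F"
    using lip M by (intro lipschitz_onI) (auto simp: dist_norm)
  then have contF: "continuous_on UNIV F" by (rule lipschitz_on_continuous_on)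
  define traj where "traj z s = w0 + exp (l * s) *\<^sub>R apply_bcontfun z s"
    for z :: "real \<Rightarrow>\<^sub>C 'a" and s :: real
  define I where "I z t = integral {0..t} (\<lambda>s. F (traj z s))" for z :: "real \<Rightarrow>\<^sub>C 'a" and t
  \<comment> \<open>The image of \<open>z\<close> under the contraction, extended to negative times by its value at 0.\<close>
  define g where "g z t = exp (- (l * max 0 t)) *\<^sub>R I z (max 0 t)" for z :: "real \<Rightarrow>\<^sub>C 'a" and t
  have cont: "continuous_on A (\<lambda>s. F (traj z s))" for A z
    unfolding traj_def by (intro continuous_on_compose2[OF contF] continuous_intros) auto
  have I_deriv: "(I z has_vector_derivative F (traj z t)) (at t within {0..})" if "0 \<le> t" for z t
    unfolding I_def by (rule integral_has_vector_derivative_halfline[OF cont that])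
  have contI: "continuous_on {0..} (I z)" for z
    by (rule continuous_on_halflineI[OF I_deriv])
  \<comment> \<open>Along the trajectory \<open>F\<close> grows at most like \<open>exp (l * s)\<close>, so \<open>g z\<close> is bounded.\<close>
  have norm_g: "norm (g z t) \<le> (norm (F w0) + M * dist z 0) / l" for z t
  proof -
    have "norm (F (traj z s)) \<le> (norm (F w0) + M * dist z 0) * exp (l * s)" if "0 \<le> s" for s
    proof -
      have "norm (F (traj z s)) \<le> norm (F w0) + norm (F (traj z s) - F w0)"
        by (metis add.commute diff_add_cancel norm_triangle_ineq)
      also have "norm (F (traj z s) - F w0) \<le> M * norm (traj z s - w0)" by (rule lip)
      also have "norm (traj z s - w0) = exp (l * s) * dist (apply_bcontfun z s) (apply_bcontfun 0 s)"
        by (simp add: traj_def)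
      also have "\<dots> \<le> exp (l * s) * dist z 0"
        by (intro mult_left_mono dist_bounded) simp
      finally have "norm (F (traj z s)) \<le> norm (F w0) + M * (exp (l * s) * dist z 0)"
        using M by simp
      moreover have "norm (F w0) * 1 \<le> norm (F w0) * exp (l * s)"
        using that l by (intro mult_left_mono) auto
      ultimately show ?thesis by (simp add: algebra_simps)
    qed
    then have "exp (- (l * max 0 t)) * norm (I z (max 0 t)) \<le> (norm (F w0) + M * dist z 0) / l"
      unfolding I_def using l M by (intro norm_integral_exp_weight_le cont) auto
    then show ?thesis by (simp add: g_def)
  qed
  have "g z \<in> bcontfun" for z
  proof -
    have "continuous_on UNIV (g z)"
      unfolding g_def by (intro continuous_intros continuous_on_compose2[OF contI]) auto
    moreover have "bounded (range (g z))"
      using norm_g by (auto simp: bounded_iff)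
    ultimately show ?thesis by (simp add: bcontfun_def)
  qed
  then have g: "apply_bcontfun (Bcontfun (g z)) = g z" for z by (rule Bcontfun_inverse)
  have "dist (Bcontfun (g y)) (Bcontfun (g z)) \<le> 1 / 2 * dist y z" for y z
  proof (rule dist_bound)
    fix t :: real
    define r where "r = max 0 t"
    have "g y t - g z t = exp (- (l * r)) *\<^sub>R integral {0..r} (\<lambda>s. F (traj y s) - F (traj z s))"
      unfolding g_def I_def r_def[symmetric]
      by (simp add: integral_diff integrable_continuous_real cont scaleR_diff_right)
    moreover have "exp (- (l * r)) * norm (integral {0..r} (\<lambda>s. F (traj y s) - F (traj z s)))
        \<le> (M * dist y z) / l"
    proof (rule norm_integral_exp_weight_le)
      fix s :: real
      have "norm (F (traj y s) - F (traj z s)) \<le> M * norm (traj y s - traj z s)" by (rule lip)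
      also have "norm (traj y s - traj z s) = exp (l * s) * dist (apply_bcontfun y s) (apply_bcontfun z s)"
        by (simp add: traj_def dist_norm scaleR_diff_right[symmetric])
      also have "\<dots> \<le> exp (l * s) * dist y z"
        by (intro mult_left_mono dist_bounded) simp
      finally show "norm (F (traj y s) - F (traj z s)) \<le> M * dist y z * exp (l * s)"
        using M by (simp add: mult_ac)
    qed (use l M in \<open>auto intro!: continuous_intros cont simp: r_def\<close>)
    ultimately show "dist (apply_bcontfun (Bcontfun (g y)) t) (apply_bcontfun (Bcontfun (g z)) t)
        \<le> 1 / 2 * dist y z"
      using M by (simp add: g dist_norm l_def)
  qed
  then obtain z where z: "Bcontfun (g z) = z"
    using banach_fix_type[of "1 / 2" "\<lambda>z. Bcontfun (g z)"] by auto
  have traj_eq: "traj z t = w0 + I z t" if "0 \<le> t" for t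
  proof -
    have "apply_bcontfun z t = g z t" using g[of z] z by simp
    with that show ?thesis by (simp add: traj_def g_def exp_minus)
  qed
  show ?thesis
  proof
    show "traj z 0 = w0" by (simp add: traj_eq I_def)
    fix t :: real
    assume t: "0 \<le> t"
    have "((\<lambda>t. w0 + I z t) has_vector_derivative F (traj z t)) (at t within {0..})"
      using I_deriv[OF t, of z] by (auto intro!: derivative_eq_intros)
    then show "(traj z has_vector_derivative F (traj z t)) (at t within {0..})"
      by (rule has_vector_derivative_transform[rotated 2]) (use t traj_eq in auto)
  qed
qed

text \<open>
  Gronwall's argument: \<open>exp(-2 L t) \<parallel>w\<^sub>1(t) - w\<^sub>2(t)\<parallel>\<^sup>2\<close> is nonincreasing and vanishes at 0.
\<close>

lemma lipschitz_ode_solution_unique: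
  fixes F :: "'a::real_inner \<Rightarrow> 'a"
  assumes L: "\<And>x y. norm (F x - F y) \<le> L * norm (x - y)"
    and cont: "continuous_on {0..} w1" "continuous_on {0..} w2"
    and w1: "\<And>t. 0 < t \<Longrightarrow> (w1 has_vector_derivative F (w1 t)) (at t)"
    and w2: "\<And>t. 0 < t \<Longrightarrow> (w2 has_vector_derivative F (w2 t)) (at t)"
    and init: "w1 0 = w2 0" and t: "0 \<le> t"
  shows "w1 t = w2 t"
proof -
  define h where "h s = exp (- (2 * L * s)) * ((w1 s - w2 s) \<bullet> (w1 s - w2 s))" for s
  have "h t \<le> h 0"
  proof (rule DERIV_nonpos_imp_decreasing_open[OF t])
    show "continuous_on {0..t} h"
      unfolding h_def
      by (intro continuous_intros continuous_on_subset[OF cont(1)] continuous_on_subset[OF cont(2)])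
        auto
    fix s :: real
    assume s: "0 < s"
    define d where "d = w1 s - w2 s"
    define p where "p = d \<bullet> (F (w1 s) - F (w2 s))"
    have "((\<lambda>s. w1 s - w2 s) has_vector_derivative F (w1 s) - F (w2 s)) (at s)"
      by (intro has_vector_derivative_diff w1 w2 s)
    from bounded_bilinear.has_vector_derivative[OF bounded_bilinear_inner this this]
    have "((\<lambda>s. (w1 s - w2 s) \<bullet> (w1 s - w2 s)) has_real_derivative 2 * p) (at s)"
      by (simp add: has_real_derivative_iff_has_vector_derivative p_def d_def inner_commute)
    then have "(h has_real_derivative exp (- (2 * L * s)) * (- (2 * L)) * (d \<bullet> d)
        + 2 * p * exp (- (2 * L * s))) (at s)"
      unfolding h_def[abs_def] d_def
      by (intro DERIV_mult) (auto intro!: derivative_eq_intros)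
    then have "(h has_real_derivative exp (- (2 * L * s)) * (2 * p - 2 * L * (d \<bullet> d))) (at s)"
      by (simp add: algebra_simps)
    moreover have "p \<le> L * (d \<bullet> d)"
    proof -
      have "p \<le> norm d * norm (F (w1 s) - F (w2 s))" unfolding p_def by (rule norm_cauchy_schwarz)
      also have "\<dots> \<le> norm d * (L * norm d)" unfolding d_def by (intro mult_left_mono L) simp
      finally show ?thesis by (simp add: dot_square_norm power2_eq_square mult_ac)
    qed
    then have "exp (- (2 * L * s)) * (2 * p - 2 * L * (d \<bullet> d)) \<le> 0"
      by (intro mult_nonneg_nonpos) auto
    ultimately show "\<exists>y. (h has_real_derivative y) (at s) \<and> y \<le> 0" by blast
  qed
  then have "(w1 t - w2 t) \<bullet> (w1 t - w2 t) \<le> 0"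
    by (simp add: h_def init mult_le_0_iff)
  then show ?thesis by (metis inner_eq_zero_iff inner_ge_zero order_antisym right_minus_eq)
qed

text \<open>
  By symmetry let \<open>\<parallel>P y\<parallel> \<le> \<parallel>P x\<parallel>\<close>, and write the difference of the two values as
  \<open>\<phi>\<^sub>x A(x - y) + (\<phi>\<^sub>x - \<phi>\<^sub>y) A y\<close>. The second term vanishes unless \<open>\<parallel>P y\<parallel> < S\<close>, and
  then \<open>\<parallel>A y\<parallel> \<le> C S\<close>: the linear growth of \<open>A\<close> is met only by a constant coefficient.
\<close>

lemma cutoff_field_lipschitz:
  fixes P :: "'a::real_vector \<Rightarrow> 'b::real_normed_vector"
    and A :: "'a \<Rightarrow> 'c::real_normed_vector"
  assumes "linear P" "linear A"
    and AP: "\<And>x. norm (A x) \<le> C * norm (P x)"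
    and lip: "\<And>a b. a \<in> {0..S\<^sup>2} \<Longrightarrow> b \<in> {0..S\<^sup>2} \<Longrightarrow> \<bar>\<phi> a - \<phi> b\<bar> \<le> K * \<bar>a - b\<bar>"
    and M: "\<And>a. a \<in> {0..S\<^sup>2} \<Longrightarrow> \<bar>\<phi> a\<bar> \<le> M"
    and nonneg: "0 \<le> S" "0 \<le> C" "0 \<le> K"
  shows "norm (\<phi> (min ((norm (P x))\<^sup>2) (S\<^sup>2)) *\<^sub>R A x - \<phi> (min ((norm (P y))\<^sup>2) (S\<^sup>2)) *\<^sub>R A y)
    \<le> (M * C + 2 * K * C * S\<^sup>2) * norm (P (x - y))"
    (is "norm (?G x - ?G y) \<le> ?L * _")
proof -
  have main: "norm (?G x - ?G y) \<le> ?L * norm (P (x - y))" if le: "norm (P y) \<le> norm (P x)" for x y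
  proof -
    define a b where "a = norm (P x)" and "b = norm (P y)"
    define fa fb where "fa = \<phi> (min (a\<^sup>2) (S\<^sup>2))" and "fb = \<phi> (min (b\<^sup>2) (S\<^sup>2))"
    define n where "n = norm (P (x - y))"
    have ab: "0 \<le> b" "b \<le> a" "0 \<le> n" using le by (auto simp: a_def b_def n_def)
    have diff: "a - b \<le> n"
      unfolding a_def b_def n_def linear_diff[OF \<open>linear P\<close>] by (rule norm_triangle_ineq2)
    have "\<bar>fa\<bar> \<le> M" unfolding fa_def by (rule M) auto
    then have "\<bar>fa\<bar> * norm (A (x - y)) \<le> M * (C * n)"
      unfolding n_def by (intro mult_mono AP) auto
    moreover have "\<bar>fa - fb\<bar> * norm (A y) \<le> 2 * K * C * S\<^sup>2 * n"
    proof (cases "S \<le> b")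
      case True
      then have "S\<^sup>2 \<le> a\<^sup>2" "S\<^sup>2 \<le> b\<^sup>2" using nonneg ab by (auto intro: power_mono)
      then have "fa = fb" by (simp add: fa_def fb_def min_absorb2)
      then show ?thesis using nonneg ab by simp
    next
      case False
      define m where "m = min a S"
      have "b \<le> m" "m \<le> S" "m \<le> a" using ab False by (auto simp: m_def)
      have "min (a\<^sup>2) (S\<^sup>2) = m\<^sup>2"
        using nonneg ab by (auto simp: m_def min_def abs_le_square_iff[symmetric])
      moreover have "min (b\<^sup>2) (S\<^sup>2) = b\<^sup>2"
        using nonneg ab False by (auto simp: min_def abs_le_square_iff[symmetric])
      ultimately have "\<bar>fa - fb\<bar> \<le> K * \<bar>m\<^sup>2 - b\<^sup>2\<bar>"
        unfolding fa_def fb_def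
        by (metis lip atLeastAtMost_iff min.cobounded2 zero_le_power2)
      also have "\<bar>m\<^sup>2 - b\<^sup>2\<bar> = (m - b) * (m + b)"
        using \<open>b \<le> m\<close> ab by (simp add: square_diff_square_factored power2_eq_square abs_mult mult.commute)
      also have "\<dots> \<le> n * (2 * S)"
        using \<open>b \<le> m\<close> \<open>m \<le> S\<close> \<open>m \<le> a\<close> ab diff by (intro mult_mono) auto
      finally have "\<bar>fa - fb\<bar> \<le> K * (n * (2 * S))" using nonneg by (simp add: mult_left_mono)
      moreover have "norm (A y) \<le> C * S"
        using AP[of y] False nonneg mult_left_mono[of b S C] by (simp add: b_def)
      ultimately have "\<bar>fa - fb\<bar> * norm (A y) \<le> (K * (n * (2 * S))) * (C * S)"
        using nonneg ab by (intro mult_mono) auto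
      then show ?thesis by (simp add: power2_eq_square mult_ac)
    qed
    moreover have "fa *\<^sub>R A x - fb *\<^sub>R A y = fa *\<^sub>R A (x - y) + (fa - fb) *\<^sub>R A y"
      by (simp add: linear_diff[OF \<open>linear A\<close>] algebra_simps)
    then have "norm (fa *\<^sub>R A x - fb *\<^sub>R A y) \<le> \<bar>fa\<bar> * norm (A (x - y)) + \<bar>fa - fb\<bar> * norm (A y)"
      by (metis norm_triangle_ineq norm_scaleR)
    ultimately show ?thesis
      unfolding fa_def fb_def a_def b_def n_def by (simp add: algebra_simps)
  qed
  have "norm (P (y - x)) = norm (P (x - y))"
    by (simp add: linear_diff[OF \<open>linear P\<close>] norm_minus_commute)
  then show ?thesis
    using main[of x y] main[of y x] norm_minus_commute[of "?G x" "?G y"]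
    by (cases "norm (P y) \<le> norm (P x)") auto
qed

section \<open>Solutions and their energy\<close>

lemma kirchhoff_solutionD:
  assumes "kirchhoff_solution \<Phi> u0 u1 u"
  shows "u 0 = u0" "hderiv u 0 = u1"
    and "\<And>t. 0 \<le> t \<Longrightarrow> (u has_vector_derivative hderiv u t) (at t within {0..})"
    and "\<And>t. 0 \<le> t \<Longrightarrow> (hderiv u has_vector_derivative hderiv (hderiv u) t) (at t within {0..})"
    and "\<And>t. 0 < t \<Longrightarrow> hderiv (hderiv u) t = \<Phi> ((norm (grad_plus (u t)))\<^sup>2) *\<^sub>R laplacian (u t)"
proof -
  show "u 0 = u0" "hderiv u 0 = u1"
    using assms by (auto simp: kirchhoff_solution_def intro: ell2_eqI)
  show "(u has_vector_derivative hderiv u t) (at t within {0..})"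
    and "(hderiv u has_vector_derivative hderiv (hderiv u) t) (at t within {0..})" if "0 \<le> t" for t
    using assms that
    by (auto simp: kirchhoff_solution_def numeral_2_eq_2 intro: has_vector_derivative_hderiv)
  show "hderiv (hderiv u) t = \<Phi> ((norm (grad_plus (u t)))\<^sup>2) *\<^sub>R laplacian (u t)" if "0 < t" for t
    using assms that
    by (intro ell2_eqI) (simp add: kirchhoff_solution_def scaleR_ell2.rep_eq scaleR_conv_of_real)
qed

lemma kirchhoff_solutionI:
  fixes u v :: "real \<Rightarrow> (int ^ 'd::finite) ell2"
  assumes \<Phi>: "continuous_on {0..} \<Phi>"
    and u: "\<And>t. 0 \<le> t \<Longrightarrow> (u has_vector_derivative v t) (at t within {0..})"
    and v: "\<And>t. 0 \<le> t \<Longrightarrow>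
      (v has_vector_derivative \<Phi> ((norm (grad_plus (u t)))\<^sup>2) *\<^sub>R laplacian (u t)) (at t within {0..})"
    and init: "u 0 = u0" "v 0 = u1"
  shows "kirchhoff_solution \<Phi> u0 u1 u"
proof -
  have hu: "hderiv u t = v t" if "0 \<le> t" for t
    using u[OF that] that by (rule hderiv_eqI)
  have v': "(hderiv u has_vector_derivative \<Phi> ((norm (grad_plus (u t)))\<^sup>2) *\<^sub>R laplacian (u t))
      (at t within {0..})" if "0 \<le> t" for t
    using v[OF that] by (rule has_vector_derivative_transform[rotated 2]) (use that hu in auto)
  then have hhu: "hderiv (hderiv u) t = \<Phi> ((norm (grad_plus (u t)))\<^sup>2) *\<^sub>R laplacian (u t)"
    if "0 \<le> t" for t
    using that by (blast intro: hderiv_eqI)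
  have cont_u: "continuous_on {0..} u" by (rule continuous_on_halflineI[OF u])
  have "continuous_on {0..} (\<lambda>t. \<Phi> ((norm (grad_plus (u t)))\<^sup>2) *\<^sub>R laplacian (u t))"
    by (intro continuous_intros continuous_on_compose2[OF \<Phi>] cont_u
        bounded_linear.continuous_on[OF bounded_linear_grad_plus]
        bounded_linear.continuous_on[OF bounded_linear_laplacian]) auto
  then have "continuous_on {0..} (hderiv (hderiv u))"
    by (rule continuous_on_eq) (simp add: hhu)
  then have "Ck_halfline 2 u"
    using u v' by (auto simp: numeral_2_eq_2 differentiable_on_def has_vector_derivative_def
        intro: differentiableI)
  then show ?thesis
    using hu hhu init
    by (simp add: kirchhoff_solution_def scaleR_ell2.rep_eq scaleR_conv_of_real)
qed

text \<open>
  The derivative of the energy is \<open>\<Phi> \<langle>\<nabla>\<^sup>+u, \<nabla>\<^sup>+u'\<rangle> + \<langle>u', u''\<rangle>\<close>, and summation by parts turns it into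
  the inner product of the equation with \<open>u'\<close>.
\<close>

lemma energy_conserved:
  fixes u :: "real \<Rightarrow> (int ^ 'd::finite) ell2"
  assumes \<Phi>: "continuous_on {0..} \<Phi>" and sol: "kirchhoff_solution \<Phi> u0 u1 u" and "0 \<le> t"
  shows "energy \<Phi> u t = energy \<Phi> u 0"
proof -
  note u = kirchhoff_solutionD[OF sol]
  define g where "g t = (norm (grad_plus (u t)))\<^sup>2" for t
  define e where "e t = \<Phi> (g t) * (grad_plus (u t) \<bullet> grad_plus (hderiv u t))
    + hderiv u t \<bullet> hderiv (hderiv u) t" for t
  have deriv: "(energy \<Phi> u has_real_derivative e t) (at t within {0..})" if t: "0 \<le> t" for t
  proof -
    have gr: "((\<lambda>t. grad_plus (u t)) has_vector_derivative grad_plus (hderiv u t)) (at t within {0..})"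
      by (rule bounded_linear.has_vector_derivative[OF bounded_linear_grad_plus u(3)[OF t]])
    have g: "(g has_real_derivative 2 * (grad_plus (u t) \<bullet> grad_plus (hderiv u t))) (at t within {0..})"
      using bounded_bilinear.has_vector_derivative[OF bounded_bilinear_inner gr gr]
      by (simp add: has_real_derivative_iff_has_vector_derivative g_def[abs_def]
          power2_norm_eq_inner inner_commute)
    have v: "((\<lambda>t. (norm (hderiv u t))\<^sup>2) has_real_derivative
        2 * (hderiv u t \<bullet> hderiv (hderiv u) t)) (at t within {0..})"
      using bounded_bilinear.has_vector_derivative[OF bounded_bilinear_inner u(4)[OF t] u(4)[OF t]]
      by (simp add: has_real_derivative_iff_has_vector_derivative power2_norm_eq_inner inner_commute)
    have "((\<lambda>s. integral {0..s} \<Phi>) has_real_derivative \<Phi> (g t)) (at (g t) within {0..})"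
      using integral_has_vector_derivative_halfline[OF \<Phi>, of "g t"]
      by (simp add: has_real_derivative_iff_has_vector_derivative g_def)
    then have "((\<lambda>s. integral {0..s} \<Phi>) has_real_derivative \<Phi> (g t)) (at (g t) within g ` {0..})"
      by (rule DERIV_subset) (auto simp: g_def)
    from DERIV_cmult[OF DERIV_add[OF DERIV_image_chain[OF this g] v], of "1 / 2"]
    have "((\<lambda>t. 1 / 2 * (integral {0..g t} \<Phi> + (norm (hderiv u t))\<^sup>2)) has_real_derivative e t)
        (at t within {0..})"
      by (simp add: o_def e_def algebra_simps)
    then show ?thesis by (simp add: energy_def[abs_def] g_def)
  qed
  \<comment> \<open>The equation is available for positive times only; continuity of the energy takes care of 0.\<close>
  have zero: "e t = 0" if "0 < t" for t
    using u(5)[OF that] by (simp add: e_def g_def inner_grad_plus inner_commute)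
  have cont: "continuous_on {0..} (energy \<Phi> u)"
    by (rule continuous_on_halflineI[where d = e])
      (use deriv in \<open>simp add: has_real_derivative_iff_has_vector_derivative\<close>)
  show ?thesis
  proof (cases "t = 0")
    case False
    show ?thesis
    proof (rule DERIV_isconst_end[of 0 t])
      show "0 < t" using False \<open>0 \<le> t\<close> by simp
      show "continuous_on {0..t} (energy \<Phi> u)" by (rule continuous_on_subset[OF cont]) auto
      show "(energy \<Phi> u has_real_derivative 0) (at s)" if "0 < s" for s
        using has_vector_derivative_at_interior[of "energy \<Phi> u" "e s" s] deriv[of s] that zero[OF that]
        by (simp add: has_real_derivative_iff_has_vector_derivative)
    qed
  qed simp
qed

lemma gradient_bound:
  fixes u :: "real \<Rightarrow> (int ^ 'd::finite) ell2"
  assumes \<Phi>: "continuous_on {0..} \<Phi>" and c: "\<And>\<eta>. 0 \<le> \<eta> \<Longrightarrow> c \<le> \<Phi> \<eta>"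
    and sol: "kirchhoff_solution \<Phi> u0 u1 u" and t: "0 \<le> t"
  shows "c * (norm (grad_plus (u t)))\<^sup>2 \<le> integral {0..(norm (grad_plus u0))\<^sup>2} \<Phi> + (norm u1)\<^sup>2"
proof -
  define r where "r = (norm (grad_plus (u t)))\<^sup>2"
  have "integral {0..r} (\<lambda>_. c) \<le> integral {0..r} \<Phi>"
    by (intro integral_le integrable_continuous_real continuous_on_subset[OF \<Phi>]) (use c in auto)
  then have "c * r \<le> integral {0..r} \<Phi>" by (simp add: r_def mult.commute)
  also have "\<dots> \<le> 2 * energy \<Phi> u t" by (simp add: energy_def r_def)
  also have "\<dots> = 2 * energy \<Phi> u 0" using energy_conserved[OF \<Phi> sol t] by simp
  finally show ?thesis
    using kirchhoff_solutionD(1,2)[OF sol] by (simp add: energy_def r_def)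
qed

section \<open>Cutting off the nonlinearity\<close>

lemma kirchhoff_solution_cong:
  assumes "kirchhoff_solution \<Phi> u0 u1 u"
    and "\<And>t. 0 \<le> t \<Longrightarrow> \<Psi> ((norm (grad_plus (u t)))\<^sup>2) = \<Phi> ((norm (grad_plus (u t)))\<^sup>2)"
  shows "kirchhoff_solution \<Psi> u0 u1 u"
  using assms by (simp add: kirchhoff_solution_def)

lemma continuous_on_cutoff:
  fixes \<Phi> :: "real \<Rightarrow> real"
  assumes "continuous_on {0..} \<Phi>" "0 \<le> R"
  shows "continuous_on {0..} (\<lambda>\<eta>. \<Phi> (min \<eta> R))"
  by (intro continuous_on_compose2[OF assms(1)] continuous_intros) (use assms in auto)

text \<open>
  The radius \<open>R\<close> is the a priori bound of \<open>gradient_bound\<close> for \<open>\<Phi>\<close>. Since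
  \<open>\<parallel>\<nabla>\<^sup>+u\<^sub>0\<parallel>\<^sup>2 \<le> R\<close>, the cut-off does not change the initial energy, so \<open>R\<close> is also the a priori
  bound for the cut-off problem, and no solution of either problem sees the cut-off.
\<close>

lemma kirchhoff_solution_cutoff_iff:
  fixes u0 u1 :: "(int ^ 'd::finite) ell2"
  assumes \<Phi>: "continuous_on {0..} \<Phi>" and c: "0 < c" "\<And>\<eta>. 0 \<le> \<eta> \<Longrightarrow> c \<le> \<Phi> \<eta>"
    and R: "c * R = integral {0..(norm (grad_plus u0))\<^sup>2} \<Phi> + (norm u1)\<^sup>2"
  shows "0 \<le> R"
    and "kirchhoff_solution (\<lambda>\<eta>. \<Phi> (min \<eta> R)) u0 u1 u \<longleftrightarrow> kirchhoff_solution \<Phi> u0 u1 u"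
proof -
  define r where "r = (norm (grad_plus u0))\<^sup>2"
  have "integral {0..r} (\<lambda>_. c) \<le> integral {0..r} \<Phi>"
    by (intro integral_le integrable_continuous_real continuous_on_subset[OF \<Phi>]) (use c in auto)
  moreover have "c * r = integral {0..r} (\<lambda>_. c)" by (simp add: r_def)
  ultimately have "c * r \<le> c * R"
    unfolding R r_def[symmetric] using zero_le_power2[of "norm u1"] by linarith
  then have r: "r \<le> R" using c by simp
  then show R0: "0 \<le> R" by (simp add: r_def order_trans[OF zero_le_power2])
  let ?\<Psi> = "\<lambda>\<eta>. \<Phi> (min \<eta> R)"
  have "integral {0..r} ?\<Psi> = integral {0..r} \<Phi>"
    by (rule integral_cong) (use r in auto)
  then have R': "c * R = integral {0..r} ?\<Psi> + (norm u1)\<^sup>2" using R by (simp add: r_def)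
  show "kirchhoff_solution ?\<Psi> u0 u1 u \<longleftrightarrow> kirchhoff_solution \<Phi> u0 u1 u"
  proof
    assume sol: "kirchhoff_solution ?\<Psi> u0 u1 u"
    have "(norm (grad_plus (u t)))\<^sup>2 \<le> R" if "0 \<le> t" for t
    proof -
      have "c * (norm (grad_plus (u t)))\<^sup>2 \<le> c * R"
        unfolding R' r_def
        by (rule gradient_bound[OF continuous_on_cutoff[OF \<Phi> R0] _ sol that]) (use c R0 in simp)
      then show ?thesis using c by simp
    qed
    then show "kirchhoff_solution \<Phi> u0 u1 u"
      by (intro kirchhoff_solution_cong[OF sol]) simp
  next
    assume sol: "kirchhoff_solution \<Phi> u0 u1 u"
    have "(norm (grad_plus (u t)))\<^sup>2 \<le> R" if "0 \<le> t" for t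
      using gradient_bound[OF \<Phi> c(2) sol that] c(1) unfolding R[symmetric] by simp
    then show "kirchhoff_solution ?\<Psi> u0 u1 u"
      by (intro kirchhoff_solution_cong[OF sol]) simp
  qed
qed

lemma C1_halfline_lipschitz:
  fixes \<Phi> :: "real \<Rightarrow> real"
  assumes "Ck_halfline 1 \<Phi>"
  obtains K where "0 \<le> K"
    and "\<And>a b. a \<in> {0..R} \<Longrightarrow> b \<in> {0..R} \<Longrightarrow> \<bar>\<Phi> a - \<Phi> b\<bar> \<le> K * \<bar>a - b\<bar>"
proof -
  have diff: "\<Phi> differentiable_on {0..}" and cont: "continuous_on {0..} (hderiv \<Phi>)"
    using assms by (simp_all add: One_nat_def)
  have "bounded (hderiv \<Phi> ` {0..R})"
    by (intro compact_imp_bounded compact_continuous_image continuous_on_subset[OF cont]) auto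
  then obtain K where K: "0 < K" "\<And>a. a \<in> {0..R} \<Longrightarrow> norm (hderiv \<Phi> a) \<le> K"
    by (auto simp: bounded_pos)
  show thesis
  proof
    show "0 \<le> K" using K by simp
    fix a b assume "a \<in> {0..R}" "b \<in> {0..R}"
    then have "norm (\<Phi> a - \<Phi> b) \<le> K * norm (a - b)"
    proof (rule field_differentiable_bound[of "{0..R}" \<Phi> "hderiv \<Phi>", rotated 3])
      fix z assume "z \<in> {0..R}"
      then show "(\<Phi> has_field_derivative hderiv \<Phi> z) (at z within {0..R})"
        using has_vector_derivative_within_subset[OF has_vector_derivative_hderiv[OF diff, of z]]
        by (auto simp: has_real_derivative_iff_has_vector_derivative)
    qed (use K in auto)
    then show "\<bar>\<Phi> a - \<Phi> b\<bar> \<le> K * \<bar>a - b\<bar>" by simp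
  qed
qed

text \<open>The right-hand side of the first-order system for the pair \<open>(u, u')\<close>.\<close>

definition cutoff_field ::
  "(real \<Rightarrow> real) \<Rightarrow> real \<Rightarrow> (int ^ 'd::finite) ell2 \<times> (int ^ 'd) ell2
    \<Rightarrow> (int ^ 'd) ell2 \<times> (int ^ 'd) ell2"
where
  "cutoff_field \<Phi> R w =
    (snd w, \<Phi> (min ((norm (grad_plus (fst w)))\<^sup>2) R) *\<^sub>R laplacian (fst w))"

lemma cutoff_field_globally_lipschitz:
  assumes \<Phi>: "Ck_halfline 1 \<Phi>" and R: "0 \<le> R"
  obtains L where "\<And>x y :: (int ^ 'd::finite) ell2 \<times> (int ^ 'd) ell2.
    norm (cutoff_field \<Phi> R x - cutoff_field \<Phi> R y) \<le> L * norm (x - y)"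
proof -
  define C where "C = 2 * real CARD('d)"
  have S: "R = (sqrt R)\<^sup>2" using R by simp
  have "continuous_on {0..R} \<Phi>"
    using \<Phi> by (auto intro: continuous_on_subset[OF differentiable_imp_continuous_on])
  then have "bounded (\<Phi> ` {0..R})"
    by (intro compact_imp_bounded compact_continuous_image) auto
  then obtain M where M: "0 < M" "\<And>a. a \<in> {0..R} \<Longrightarrow> \<bar>\<Phi> a\<bar> \<le> M"
    by (auto simp: bounded_pos)
  obtain K where K: "0 \<le> K"
    "\<And>a b. a \<in> {0..R} \<Longrightarrow> b \<in> {0..R} \<Longrightarrow> \<bar>\<Phi> a - \<Phi> b\<bar> \<le> K * \<bar>a - b\<bar>"
    using C1_halfline_lipschitz[OF \<Phi>] by metis
  obtain B where B: "\<And>f :: (int ^ 'd) ell2. norm (grad_plus f) \<le> norm f * B" "0 \<le> B"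
    using bounded_linear.nonneg_bounded[OF bounded_linear_grad_plus] by blast
  define L where "L = (M * C + 2 * K * C * R) * B"
  have L0: "0 \<le> M * C + 2 * K * C * R" using M K R by (simp add: C_def)
  have force: "norm (\<Phi> (min ((norm (grad_plus f))\<^sup>2) R) *\<^sub>R laplacian f
      - \<Phi> (min ((norm (grad_plus g))\<^sup>2) R) *\<^sub>R laplacian g) \<le> L * norm (f - g)"
    for f g :: "(int ^ 'd) ell2"
  proof -
    have "norm (\<Phi> (min ((norm (grad_plus f))\<^sup>2) ((sqrt R)\<^sup>2)) *\<^sub>R laplacian f
        - \<Phi> (min ((norm (grad_plus g))\<^sup>2) ((sqrt R)\<^sup>2)) *\<^sub>R laplacian g)
        \<le> (M * C + 2 * K * C * (sqrt R)\<^sup>2) * norm (grad_plus (f - g))"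
      by (rule cutoff_field_lipschitz)
        (use K M R in \<open>auto simp: C_def linear_laplacian bounded_linear_grad_plus
          bounded_linear.linear norm_laplacian_le\<close>)
    also have "\<dots> \<le> (M * C + 2 * K * C * R) * (norm (f - g) * B)"
      using R L0 by (simp add: mult_left_mono B)
    finally show ?thesis using R by (simp add: L_def mult_ac)
  qed
  have "norm (cutoff_field \<Phi> R x - cutoff_field \<Phi> R y) \<le> (1 + L) * norm (x - y)"
    for x y :: "(int ^ 'd) ell2 \<times> (int ^ 'd) ell2"
  proof -
    have comp: "norm (fst x - fst y) \<le> norm (x - y)" "norm (snd x - snd y) \<le> norm (x - y)"
      by (metis norm_fst_le prod.collapse fst_diff, metis norm_snd_le prod.collapse snd_diff)
    have "norm (cutoff_field \<Phi> R x - cutoff_field \<Phi> R y)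
        \<le> norm (snd x - snd y) + L * norm (fst x - fst y)"
      unfolding cutoff_field_def diff_Pair
      by (rule order_trans[OF norm_Pair_le add_left_mono[OF force]])
    also have "\<dots> \<le> norm (x - y) + L * norm (x - y)"
      using comp L0 B by (intro add_mono mult_left_mono) (auto simp: L_def)
    finally show ?thesis by (simp add: algebra_simps)
  qed
  then show thesis by (rule that)
qed

lemma kirchhoff_cutoff_well_posed:
  fixes u0 u1 :: "(int ^ 'd::finite) ell2"
  assumes \<Phi>: "Ck_halfline 1 \<Phi>" and R: "0 \<le> R"
  shows "\<exists>u. kirchhoff_solution (\<lambda>\<eta>. \<Phi> (min \<eta> R)) u0 u1 u \<and>
    (\<forall>v. kirchhoff_solution (\<lambda>\<eta>. \<Phi> (min \<eta> R)) u0 u1 v \<longrightarrow> (\<forall>t\<ge>0. v t = u t))"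
proof -
  let ?\<Psi> = "\<lambda>\<eta>. \<Phi> (min \<eta> R)"
  let ?F = "cutoff_field \<Phi> R :: (int ^ 'd) ell2 \<times> (int ^ 'd) ell2 \<Rightarrow> _"
  have "continuous_on {0..} \<Phi>" using \<Phi> by (simp add: differentiable_imp_continuous_on)
  then have \<Psi>: "continuous_on {0..} ?\<Psi>" using R by (rule continuous_on_cutoff)
  obtain L where L: "\<And>x y. norm (?F x - ?F y) \<le> L * norm (x - y)"
    using cutoff_field_globally_lipschitz[OF \<Phi> R] by blast
  obtain w where w: "w 0 = (u0, u1)"
    "\<And>t. 0 \<le> t \<Longrightarrow> (w has_vector_derivative ?F (w t)) (at t within {0..})"
    using lipschitz_ode_solution_exists[OF L, of "(u0, u1)"] by blast
  show ?thesis
  proof (intro exI conjI allI impI)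
    have fst': "((\<lambda>t. fst (w t)) has_vector_derivative snd (w t)) (at t within {0..})"
      if "0 \<le> t" for t
      using bounded_linear.has_vector_derivative[OF bounded_linear_fst w(2)[OF that]]
      by (simp add: cutoff_field_def)
    have snd': "((\<lambda>t. snd (w t)) has_vector_derivative
        ?\<Psi> ((norm (grad_plus (fst (w t))))\<^sup>2) *\<^sub>R laplacian (fst (w t))) (at t within {0..})"
      if "0 \<le> t" for t
      using bounded_linear.has_vector_derivative[OF bounded_linear_snd w(2)[OF that]]
      by (simp add: cutoff_field_def)
    show "kirchhoff_solution ?\<Psi> u0 u1 (\<lambda>t. fst (w t))"
      by (rule kirchhoff_solutionI[OF \<Psi> fst' snd']) (simp_all add: w)
    fix v and t :: real
    assume sol: "kirchhoff_solution ?\<Psi> u0 u1 v" and t: "0 \<le> t"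
    note v = kirchhoff_solutionD[OF sol]
    define p where "p t = (v t, hderiv v t)" for t
    have p': "(p has_vector_derivative (hderiv v t, hderiv (hderiv v) t)) (at t within {0..})"
      if "0 \<le> t" for t
      unfolding p_def by (intro has_vector_derivative_Pair v(3,4) that)
    have "p t = w t"
    proof (rule lipschitz_ode_solution_unique[OF L])
      show "continuous_on {0..} p" by (rule continuous_on_halflineI[OF p'])
      show "continuous_on {0..} w" by (rule continuous_on_halflineI[OF w(2)])
      show "(p has_vector_derivative ?F (p s)) (at s)" if "0 < s" for s
        using has_vector_derivative_at_interior[OF p' that] v(5)[OF that] that
        by (simp add: p_def cutoff_field_def)
      show "(w has_vector_derivative ?F (w s)) (at s)" if "0 < s" for s
        using has_vector_derivative_at_interior[OF w(2) that] that by simp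
      show "p 0 = w 0" by (simp add: p_def v w)
    qed (rule t)
    then show "v t = fst (w t)" by (metis p_def fst_conv)
  qed
qed

section \<open>Global well-posedness and energy conservation\<close>

theorem theorem2p2:
  fixes \<Phi> :: "real \<Rightarrow> real"
    and u0 u1 :: "(int ^ 'd::finite) ell2"
  assumes "Ck_halfline 1 \<Phi>"
    and "(INF \<eta>\<in>{0..}. ereal (\<Phi> \<eta>)) > 0"
  shows "\<exists>u. kirchhoff_solution \<Phi> u0 u1 u \<and>
             (\<forall>v. kirchhoff_solution \<Phi> u0 u1 v \<longrightarrow> (\<forall>t\<ge>0. v t = u t)) \<and>
             (\<forall>t>0. energy \<Phi> u t = energy \<Phi> u 0)"
proof -
  have \<Phi>: "continuous_on {0..} \<Phi>" using assms(1) by (simp add: differentiable_imp_continuous_on)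
  obtain c where c: "0 < ereal c" "ereal c < (INF \<eta>\<in>{0..}. ereal (\<Phi> \<eta>))"
    using ereal_dense2[OF assms(2)] by blast
  have c0: "0 < c" using c(1) by simp
  have c_le: "c \<le> \<Phi> \<eta>" if "0 \<le> \<eta>" for \<eta>
  proof -
    have "ereal c < ereal (\<Phi> \<eta>)" by (rule less_le_trans[OF c(2) INF_lower]) (use that in simp)
    then show ?thesis by simp
  qed
  define R where "R = (integral {0..(norm (grad_plus u0))\<^sup>2} \<Phi> + (norm u1)\<^sup>2) / c"
  have R: "c * R = integral {0..(norm (grad_plus u0))\<^sup>2} \<Phi> + (norm u1)\<^sup>2"
    using c0 by (simp add: R_def)
  have R0: "0 \<le> R"
    by (rule kirchhoff_solution_cutoff_iff(1)[OF \<Phi> c0 _ R]) (rule c_le)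
  have iff: "kirchhoff_solution (\<lambda>\<eta>. \<Phi> (min \<eta> R)) u0 u1 u \<longleftrightarrow> kirchhoff_solution \<Phi> u0 u1 u" for u
    by (rule kirchhoff_solution_cutoff_iff(2)[OF \<Phi> c0 _ R]) (rule c_le)
  obtain u where u: "kirchhoff_solution \<Phi> u0 u1 u"
    and unique: "\<forall>v. kirchhoff_solution \<Phi> u0 u1 v \<longrightarrow> (\<forall>t\<ge>0. v t = u t)"
    using kirchhoff_cutoff_well_posed[OF assms(1) R0, of u0 u1] unfolding iff by blast
  have "energy \<Phi> u t = energy \<Phi> u 0" if "0 < t" for t
    by (rule energy_conserved[OF \<Phi> u less_imp_le[OF that]])
  with u unique show ?thesis by blast
qed

end
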